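(* Let $n\in\mathbb{N}$, $n\geq 1$. If Conjecture B holds for $n-1$, then every Lonely Runner Zonotope $Z=\sum_{i=1}^n[\mathbf 0,\mathbf u_i]\subseteq\mathbb{R}^{n-1}$ that violates Conjecture B for $n$, i.e. for which $$\frac{n-1}{n+1}(Z-\mathbf x)\cap(\mathbf x+\mathbb{Z}^{n-1})=\varnothing,\qquad \mathbf x=\tfrac12(\mathbf u_1+\dots+\mathbf u_n),$$ contains at most $\binom{n+1}{2}^{n-1}$ points of $\mathbb{Z}^{n-1}$.
   Context: A Lonely Runner Zonotope (LRZ) of dimension $m-1$ is a zonotope $Z=\sum_{i=1}^m[\mathbf 0,\mathbf u_i]\subseteq\mathbb{R}^{m-1}$ with $m$ generators $\mathbf u_i\in\mathbb{Z}^{m-1}$ in linear general position, i.e. every $m-1$ of the $\mathbf u_i$ are linearly independent. "Conjecture B holds for $m$" (the zonotopal form of the Lonely Runner Conjecture) means: for every Lonely Runner Zonotope $Z=\sum_{i=1}^m[\mathbf 0,\mathbf u_i]$ of dimension $m-1$ one has $$\frac{m-1}{m+1}(Z-\mathbf x)\cap(\mathbf x+\mathbb{Z}^{m-1})\ne\varnothing,$$ where $\mathbf x=\frac12(\mathbf u_1+\dots+\mathbf u_m)$ is the center of $Z$. For $m=0$ the statement is regarded as vacuously true. *)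

theory Defs
  imports Complex_Main "Jordan_Normal_Form.VS_Connect"
begin

definition int_lattice :: "nat \<Rightarrow> real vec set" where
  "int_lattice d = {v \<in> carrier_vec d. \<forall>j<d. v $ j \<in> \<int>}"

(* The Minkowski sum of the segments [0, u i] for i < m, inside R^d. *)
definition zonotope :: "nat \<Rightarrow> nat \<Rightarrow> (nat \<Rightarrow> real vec) \<Rightarrow> real vec set" where
  "zonotope d m u =
     {finsum_vec TYPE(real) d (\<lambda>i. t i \<cdot>\<^sub>v u i) {..<m} | t. \<forall>i<m. 0 \<le> t i \<and> t i \<le> 1}"

definition zonotope_center :: "nat \<Rightarrow> nat \<Rightarrow> (nat \<Rightarrow> real vec) \<Rightarrow> real vec" where
  "zonotope_center d m u = (1 / 2) \<cdot>\<^sub>v finsum_vec TYPE(real) d u {..<m}"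

(* lin_dep speaks about sets of vectors; together with injectivity on I it expresses
   independence of the indexed family, so a repeated generator counts as a dependency. *)
definition lin_indpt_family :: "nat \<Rightarrow> (nat \<Rightarrow> real vec) \<Rightarrow> nat set \<Rightarrow> bool" where
  "lin_indpt_family d u I \<longleftrightarrow>
     inj_on u I \<and> \<not> module.lin_dep class_ring (module_vec TYPE(real) d) (u ` I)"

definition general_position :: "nat \<Rightarrow> nat \<Rightarrow> (nat \<Rightarrow> real vec) \<Rightarrow> bool" where
  "general_position d m u \<longleftrightarrow>
     (\<forall>I. I \<subseteq> {..<m} \<and> card I = d \<longrightarrow> lin_indpt_family d u I)"

(* "u 0, ..., u (m - 1) generate a Lonely Runner Zonotope of dimension m - 1".
   The condition 1 \<le> m rules out the truncated difference 0 - 1 = 0; for m = 1 the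
   ambient space is R^0. *)
definition lonely_runner_zonotope :: "nat \<Rightarrow> (nat \<Rightarrow> real vec) \<Rightarrow> bool" where
  "lonely_runner_zonotope m u \<longleftrightarrow>
     1 \<le> m \<and> (\<forall>i<m. u i \<in> int_lattice (m - 1)) \<and> general_position (m - 1) m u"

(* The sets (m - 1)/(m + 1) (Z - x) and x + Z^(m - 1) intersect, x being the center of Z. *)
definition satisfies_B :: "nat \<Rightarrow> (nat \<Rightarrow> real vec) \<Rightarrow> bool" where
  "satisfies_B m u \<longleftrightarrow>
     (let d = m - 1; x = zonotope_center d m u in
       (\<lambda>z. ((real m - 1) / (real m + 1)) \<cdot>\<^sub>v (z - x)) ` zonotope d m u
         \<inter> (\<lambda>p. x + p) ` int_lattice d \<noteq> {})"

(* Vacuously true for m = 0. *)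
definition conjecture_B :: "nat \<Rightarrow> bool" where
  "conjecture_B m \<longleftrightarrow> (\<forall>u. lonely_runner_zonotope m u \<longrightarrow> satisfies_B m u)"

end

theory Submission
  imports Defs
begin

text \<open>
  A point of \<open>(m - 1)/(m + 1) (Z - x) \<inter> (x + \<int>\<^sup>m\<^sup>-\<^sup>1)\<close> amounts to coefficients
  \<open>t\<^sub>i \<in> [1/(m + 1), m/(m + 1)]\<close> for which \<open>\<Sum> t\<^sub>i u\<^sub>i\<close> is a lattice point.

  Put \<open>N = (n + 1) choose 2\<close>. If \<open>Z\<close> has more than \<open>N\<^sup>n\<^sup>-\<^sup>1\<close> lattice points, two of them are congruent
  modulo \<open>N\<close>, so there is a lattice vector \<open>w = \<Sum> r\<^sub>i u\<^sub>i \<noteq> 0\<close> with \<open>\<bar>r\<^sub>i\<bar> \<le> 1/N\<close>. Project along \<open>w\<close>. Let \<open>v\<close>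
  span the relations between the \<open>u\<^sub>i\<close>; the projected generators then have the relation space spanned
  by \<open>r\<close> and \<open>v\<close>. If \<open>r\<^sub>i/v\<^sub>i < r\<^sub>j/v\<^sub>j\<close> are consecutive among these slopes, replacing the projections
  of \<open>u\<^sub>i\<close>, \<open>u\<^sub>j\<close> by that of \<open>u\<^sub>i + s u\<^sub>j\<close> with \<open>s = - sgn (v\<^sub>i v\<^sub>j)\<close> leaves \<open>n - 1\<close> generators in general
  position, and Conjecture B for \<open>n - 1\<close> gives \<open>t\<^sub>i \<in> [1/n, (n - 1)/n]\<close> such that \<open>\<Sum> t\<^sub>i u\<^sub>i\<close> is a lattice
  point up to a multiple of \<open>w\<close>. That multiple may be taken in \<open>[-1/2, 1/2]\<close>, so correcting for it
  moves \<open>t\<^sub>i\<close> by at most \<open>1/(2N) = 1/n - 1/(n + 1)\<close>.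
\<close>

section \<open>Generators as coordinate arrays, and Conjecture B in terms of coefficients\<close>

definition relation :: "nat \<Rightarrow> nat \<Rightarrow> (nat \<Rightarrow> nat \<Rightarrow> real) \<Rightarrow> (nat \<Rightarrow> real) \<Rightarrow> bool" where
  "relation d m U a \<longleftrightarrow> (\<forall>j<d. (\<Sum>i<m. a i * U i j) = 0)"

text \<open>General position is phrased through relations, because the effect of projecting and
  merging generators is read off from their relation space.\<close>

definition gen_pos :: "nat \<Rightarrow> nat \<Rightarrow> (nat \<Rightarrow> nat \<Rightarrow> real) \<Rightarrow> bool" where
  "gen_pos d m U \<longleftrightarrow> (\<forall>a. relation d m U a \<longrightarrow> (\<exists>k<m. a k = 0) \<longrightarrow> (\<forall>i<m. a i = 0))"

definition integral_gens :: "nat \<Rightarrow> nat \<Rightarrow> (nat \<Rightarrow> nat \<Rightarrow> real) \<Rightarrow> bool" where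
  "integral_gens d m U \<longleftrightarrow> (\<forall>i<m. \<forall>j<d. U i j \<in> \<int>)"

definition lonely_coeffs :: "nat \<Rightarrow> nat \<Rightarrow> (nat \<Rightarrow> nat \<Rightarrow> real) \<Rightarrow> bool" where
  "lonely_coeffs d m U \<longleftrightarrow>
     (\<exists>t. (\<forall>i<m. 1 / (real m + 1) \<le> t i \<and> t i \<le> real m / (real m + 1)) \<and>
          (\<forall>j<d. (\<Sum>i<m. t i * U i j) \<in> \<int>))"

lemma lin_indpt_family_iff:
  assumes I: "finite I" and u: "u ` I \<subseteq> carrier_vec d"
  shows "lin_indpt_family d u I \<longleftrightarrow>
    (\<forall>a. (\<forall>j<d. (\<Sum>i\<in>I. a i * u i $ j) = 0) \<longrightarrow> (\<forall>i\<in>I. a i = 0))"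
    (is "?L \<longleftrightarrow> ?R")
proof -
  interpret vec_space "TYPE(real)" d .
  show ?thesis
  proof
    assume ?L
    hence inj: "inj_on u I" and li: "lin_indpt (u ` I)"
      by (auto simp: lin_indpt_family_def)
    show ?R
    proof (intro allI impI ballI)
      fix a i assume a: "\<forall>j<d. (\<Sum>i\<in>I. a i * u i $ j) = 0" and i: "i \<in> I"
      \<comment> \<open>\<open>lincomb\<close> takes coefficients indexed by vectors; injectivity of
        \<open>u\<close> lets the index coefficients be carried over.\<close>
      let ?b = "\<lambda>v. a (the_inv_into I u v)"
      have "lincomb ?b (u ` I) = 0\<^sub>v d"
      proof (rule eq_vecI)
        fix j assume "j < dim_vec (0\<^sub>v d :: real vec)"
        hence j: "j < d" by simp
        have "lincomb ?b (u ` I) $ j = (\<Sum>v\<in>u ` I. ?b v * v $ j)"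
          by (rule lincomb_index[OF j u])
        also have "\<dots> = (\<Sum>i\<in>I. a i * u i $ j)"
          by (subst sum.reindex[OF inj]) (auto simp: the_inv_into_f_f[OF inj] intro!: sum.cong)
        finally show "lincomb ?b (u ` I) $ j = 0\<^sub>v d $ j" using a j by simp
      next
        show "dim_vec (lincomb ?b (u ` I)) = dim_vec (0\<^sub>v d)"
          using lincomb_dim[OF _ u] I by simp
      qed
      moreover have "u i \<in> u ` I" using i by simp
      ultimately have "?b (u i) = 0"
        using lin_dep_crit[where A = "u ` I" and S = "u ` I" and a = ?b and v = "u i"] I li
        by (auto simp: class_ring_simps)
      thus "a i = 0" by (simp add: the_inv_into_f_f[OF inj i])
    qed
  next
    assume R: ?R
    have inj: "inj_on u I"
    proof (rule inj_onI, rule ccontr)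
      fix x y assume x: "x \<in> I" and y: "y \<in> I" and xy: "u x = u y" and ne: "x \<noteq> y"
      let ?a = "\<lambda>i. if i = x then 1 else if i = y then - 1 else (0::real)"
      have "(\<Sum>i\<in>I. ?a i * u i $ j) = 0" for j
      proof -
        have "(\<Sum>i\<in>I. ?a i * u i $ j)
            = (\<Sum>i\<in>I. (if i = x then u i $ j else 0) - (if i = y then u i $ j else 0))"
          using ne by (intro sum.cong) auto
        also have "\<dots> = u x $ j - u y $ j"
          using I x y by (simp add: sum_subtractf)
        also have "\<dots> = 0" by (simp only: xy diff_self)
        finally show ?thesis .
      qed
      hence "?a x = 0" by (intro R[rule_format, of ?a, OF _ x])
      thus False by simp
    qed
    have "lin_indpt (u ` I)"
    proof (rule finite_lin_indpt2)
      show "finite (u ` I)" using I by simp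
      show "u ` I \<subseteq> carrier_vec d" by (rule u)
      fix b assume lc: "lincomb b (u ` I) = 0\<^sub>v d"
      have "(\<Sum>i\<in>I. b (u i) * u i $ j) = 0" if j: "j < d" for j
      proof -
        have "0 = lincomb b (u ` I) $ j" using lc j by simp
        also have "\<dots> = (\<Sum>v\<in>u ` I. b v * v $ j)" by (rule lincomb_index[OF j u])
        also have "\<dots> = (\<Sum>i\<in>I. b (u i) * u i $ j)"
          by (subst sum.reindex[OF inj]) simp
        finally show ?thesis by simp
      qed
      hence "\<forall>i\<in>I. b (u i) = 0" by (intro ballI R[rule_format, of "\<lambda>i. b (u i)"])
      thus "\<forall>v\<in>u ` I. b v = 0" by simp
    qed
    thus ?L using inj by (simp add: lin_indpt_family_def)
  qed
qed

text \<open>A choice of \<open>m - 1\<close> out of \<open>m\<close> generators omits exactly one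
  index \<open>k\<close>, and its relations are the relations between all generators that vanish at
  \<open>k\<close>.\<close>

lemma general_position_iff_gen_pos:
  assumes m: "m \<ge> 1" and u: "\<forall>i<m. u i \<in> carrier_vec (m - 1)"
  shows "general_position (m - 1) m u \<longleftrightarrow> gen_pos (m - 1) m (\<lambda>i j. u i $ j)"
proof
  assume gp: "general_position (m - 1) m u"
  show "gen_pos (m - 1) m (\<lambda>i j. u i $ j)"
    unfolding gen_pos_def
  proof (intro allI impI)
    fix a i assume rel: "relation (m - 1) m (\<lambda>i j. u i $ j) a" and "\<exists>k<m. a k = 0" and i: "i < m"
    then obtain k where k: "k < m" "a k = 0" by auto
    let ?I = "{..<m} - {k}"
    have "lin_indpt_family (m - 1) u ?I"
      using gp k unfolding general_position_def by auto
    moreover have "u ` ?I \<subseteq> carrier_vec (m - 1)" using u by auto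
    moreover have "(\<Sum>i\<in>?I. a i * u i $ j) = 0" if "j < m - 1" for j
      using rel that k by (simp add: relation_def sum.remove[of "{..<m}" k])
    ultimately have "\<forall>i\<in>?I. a i = 0"
      using lin_indpt_family_iff[of ?I u "m - 1"] by blast
    thus "a i = 0" using i k by (cases "i = k") auto
  qed
next
  assume gp: "gen_pos (m - 1) m (\<lambda>i j. u i $ j)"
  show "general_position (m - 1) m u"
    unfolding general_position_def
  proof (intro allI impI)
    fix I assume I: "I \<subseteq> {..<m} \<and> card I = m - 1"
    hence fin: "finite I" using finite_subset by blast
    have uI: "u ` I \<subseteq> carrier_vec (m - 1)" using u I by auto
    from I m have "I \<noteq> {..<m}" by auto
    then obtain k where k: "k < m" "k \<notin> I" using I by auto
    show "lin_indpt_family (m - 1) u I"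
      unfolding lin_indpt_family_iff[OF fin uI]
    proof (intro allI impI ballI)
      fix a i assume a: "\<forall>j<m - 1. (\<Sum>i\<in>I. a i * u i $ j) = 0" and i: "i \<in> I"
      let ?b = "\<lambda>i. if i \<in> I then a i else 0"
      have "(\<Sum>i<m. ?b i * u i $ j) = (\<Sum>i\<in>I. a i * u i $ j)" for j
        using I by (intro sum.mono_neutral_cong_right) auto
      hence "relation (m - 1) m (\<lambda>i j. u i $ j) ?b"
        using a by (simp add: relation_def)
      moreover have "?b k = 0" using k by simp
      ultimately have "?b i = 0"
        using gp[unfolded gen_pos_def, rule_format, of ?b i] k i I by blast
      thus "a i = 0" using i by simp
    qed
  qed
qed

lemma lonely_runner_zonotope_iff:
  "lonely_runner_zonotope m u \<longleftrightarrow>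
    1 \<le> m \<and> (\<forall>i<m. u i \<in> carrier_vec (m - 1)) \<and>
    integral_gens (m - 1) m (\<lambda>i j. u i $ j) \<and> gen_pos (m - 1) m (\<lambda>i j. u i $ j)"
proof -
  have "(\<forall>i<m. u i \<in> int_lattice (m - 1)) \<longleftrightarrow>
      (\<forall>i<m. u i \<in> carrier_vec (m - 1)) \<and> integral_gens (m - 1) m (\<lambda>i j. u i $ j)"
    unfolding integral_gens_def int_lattice_def mem_Collect_eq by (rule iffI) (simp; fail)+
  thus ?thesis
    using general_position_iff_gen_pos[of m u] unfolding lonely_runner_zonotope_def by argo
qed

text \<open>A coefficient \<open>s\<close> of a point of \<open>Z\<close> is matched with \<open>t = 1/2 - c (s - 1/2)\<close>,
  where \<open>c = (m - 1)/(m + 1)\<close>.\<close>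
lemma satisfies_B_iff_lonely_coeffs:
  assumes m: "m \<ge> 1" and u: "\<forall>i<m. u i \<in> carrier_vec (m - 1)"
  shows "satisfies_B m u \<longleftrightarrow> lonely_coeffs (m - 1) m (\<lambda>i j. u i $ j)"
proof -
  define d where "d = m - 1"
  define c where "c = (real m - 1) / (real m + 1)"
  define Z where "Z = (\<lambda>s. finsum_vec TYPE(real) d (\<lambda>i. s i \<cdot>\<^sub>v u i) {..<m})"
  define x where "x = zonotope_center d m u"
  have ud: "\<And>i. i < m \<Longrightarrow> u i \<in> carrier_vec d" using u by (simp add: d_def)
  have Zc: "Z s \<in> carrier_vec d" for s
    unfolding Z_def by (rule finsum_vec_closed) (use ud in auto)
  have Zi: "Z s $ j = (\<Sum>i<m. s i * u i $ j)" if "j < d" for s j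
    unfolding Z_def
    by (subst index_finsum_vec) (use ud that in \<open>auto intro!: sum.cong dest!: carrier_vecD[OF ud]\<close>)
  have sc: "finsum_vec TYPE(real) d u {..<m} \<in> carrier_vec d"
    by (rule finsum_vec_closed) (use ud in auto)
  hence xc: "x \<in> carrier_vec d"
    unfolding x_def zonotope_center_def by simp
  have xi: "x $ j = (\<Sum>i<m. (1/2) * u i $ j)" if j: "j < d" for j
  proof -
    have "finsum_vec TYPE(real) d u {..<m} $ j = (\<Sum>i<m. u i $ j)"
      by (subst index_finsum_vec) (use ud j in auto)
    thus ?thesis
      using j sc by (simp add: x_def zonotope_center_def sum_distrib_left sum_divide_distrib)
  qed
  have c0: "c \<ge> 0" using m by (simp add: c_def)
  have c1: "1 / (real m + 1) = 1/2 - c/2" "real m / (real m + 1) = 1/2 + c/2"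
    by (simp_all add: c_def field_simps)
  have B: "satisfies_B m u \<longleftrightarrow>
      (\<exists>s. (\<forall>i<m. 0 \<le> s i \<and> s i \<le> 1) \<and> c \<cdot>\<^sub>v (Z s - x) \<in> (\<lambda>p. x + p) ` int_lattice d)"
  proof -
    have "zonotope d m u = Z ` {s. \<forall>i<m. 0 \<le> s i \<and> s i \<le> 1}"
      by (auto simp: zonotope_def Z_def)
    hence "satisfies_B m u \<longleftrightarrow> (\<lambda>z. c \<cdot>\<^sub>v (z - x)) ` Z ` {s. \<forall>i<m. 0 \<le> s i \<and> s i \<le> 1}
        \<inter> (\<lambda>p. x + p) ` int_lattice d \<noteq> {}"
      unfolding satisfies_B_def Let_def d_def[symmetric] c_def[symmetric] x_def[symmetric]
      by simp
    moreover have "f ` S \<inter> A \<noteq> {} \<longleftrightarrow> (\<exists>s. s \<in> S \<and> f s \<in> A)"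
      for f :: "(nat \<Rightarrow> real) \<Rightarrow> real vec" and S A
      by blast
    ultimately show ?thesis by (simp only: image_image mem_Collect_eq)
  qed
  have shift: "c \<cdot>\<^sub>v (Z s - x) \<in> (\<lambda>p. x + p) ` int_lattice d \<longleftrightarrow>
      (\<forall>j<d. (\<Sum>i<m. (1/2 - c * (s i - 1/2)) * u i $ j) \<in> \<int>)" (is "?l \<longleftrightarrow> ?r") for s
  proof -
    have ci: "(c \<cdot>\<^sub>v (Z s - x) - x) $ j = - (\<Sum>i<m. (1/2 - c * (s i - 1/2)) * u i $ j)"
      if "j < d" for j
    proof -
      have "(c \<cdot>\<^sub>v (Z s - x) - x) $ j = c * (Z s $ j - x $ j) - x $ j"
        using that Zc[of s] xc by simp
      also have "\<dots> = - (\<Sum>i<m. (1/2 - c * (s i - 1/2)) * u i $ j)"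
        unfolding Zi[OF that] xi[OF that] sum_negf[symmetric] sum_subtractf[symmetric]
          sum_distrib_left
        by (intro sum.cong) (auto simp: algebra_simps)
      finally show ?thesis .
    qed
    have "?l \<longleftrightarrow> c \<cdot>\<^sub>v (Z s - x) - x \<in> int_lattice d"
    proof
      assume ?l
      then obtain p where p: "p \<in> int_lattice d" and e: "c \<cdot>\<^sub>v (Z s - x) = x + p" by auto
      have "p \<in> carrier_vec d" using p by (simp add: int_lattice_def)
      hence "x + p - x = p" using xc by (intro eq_vecI) auto
      thus "c \<cdot>\<^sub>v (Z s - x) - x \<in> int_lattice d" using p e by simp
    next
      assume *: "c \<cdot>\<^sub>v (Z s - x) - x \<in> int_lattice d"
      have "c \<cdot>\<^sub>v (Z s - x) = x + (c \<cdot>\<^sub>v (Z s - x) - x)"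
        using xc Zc[of s] by (intro eq_vecI) auto
      thus ?l using * by (rule image_eqI)
    qed
    also have "\<dots> \<longleftrightarrow> (\<forall>j<d. (c \<cdot>\<^sub>v (Z s - x) - x) $ j \<in> \<int>)"
      using xc Zc[of s] by (auto simp: int_lattice_def)
    also have "\<dots> \<longleftrightarrow> ?r"
      by (simp only: ci minus_in_Ints_iff cong: imp_cong)
    finally show ?thesis .
  qed
  have "satisfies_B m u \<longleftrightarrow> lonely_coeffs d m (\<lambda>i j. u i $ j)"
  proof
    assume "satisfies_B m u"
    then obtain s where s: "\<forall>i<m. 0 \<le> s i \<and> s i \<le> 1"
      and t: "\<forall>j<d. (\<Sum>i<m. (1/2 - c * (s i - 1/2)) * u i $ j) \<in> \<int>"
      unfolding B shift by blast
    have "1/2 - c/2 \<le> 1/2 - c * (s i - 1/2) \<and> 1/2 - c * (s i - 1/2) \<le> 1/2 + c/2" if "i < m" for i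
    proof -
      have "c * s i \<le> c * 1" "0 \<le> c * s i"
        using s that c0 mult_left_mono[of "s i" 1 c] by auto
      thus ?thesis by (simp add: algebra_simps)
    qed
    thus "lonely_coeffs d m (\<lambda>i j. u i $ j)"
      unfolding lonely_coeffs_def c1
      by (intro exI[of _ "\<lambda>i. 1/2 - c * (s i - 1/2)"] conjI allI impI t[rule_format]) auto
  next
    assume "lonely_coeffs d m (\<lambda>i j. u i $ j)"
    then obtain t where t: "\<forall>i<m. 1/2 - c/2 \<le> t i \<and> t i \<le> 1/2 + c/2"
      and ti: "\<forall>j<d. (\<Sum>i<m. t i * u i $ j) \<in> \<int>"
      unfolding lonely_coeffs_def c1 by blast
    \<comment> \<open>Inverts the substitution. For \<open>m = 1\<close> one has
      \<open>c = 0\<close>, and division by zero gives \<open>s i = 1/2\<close>; this fits, since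
      the bounds then force \<open>t i = 1/2\<close>.\<close>
    define s where "s = (\<lambda>i. 1/2 + (1/2 - t i) / c)"
    have s01: "0 \<le> s i \<and> s i \<le> 1" and st: "1/2 - c * (s i - 1/2) = t i" if "i < m" for i
    proof -
      have ti: "1/2 - c/2 \<le> t i" "t i \<le> 1/2 + c/2" using t that by auto
      show "0 \<le> s i \<and> s i \<le> 1"
        using ti c0 by (cases "c = 0") (auto simp: s_def field_simps)
      show "1/2 - c * (s i - 1/2) = t i"
        using ti by (cases "c = 0") (auto simp: s_def)
    qed
    have "(\<Sum>i<m. (1/2 - c * (s i - 1/2)) * u i $ j) = (\<Sum>i<m. t i * u i $ j)" for j
      using st by (intro sum.cong) auto
    thus "satisfies_B m u"
      unfolding B shift by (intro exI[of _ s]) (use s01 ti in simp)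
  qed
  thus ?thesis by (simp add: d_def)
qed

section \<open>The relation space of generators in general position\<close>

text \<open>More vectors than dimensions are dependent, and general position lets no coefficient of
  a nontrivial relation vanish.\<close>

lemma ex_nowhere_zero_relation:
  assumes gp: "gen_pos m (Suc m) U"
  obtains v where "relation m (Suc m) U v" "\<And>i. i \<le> m \<Longrightarrow> v i \<noteq> 0"
proof -
  \<comment> \<open>The additional zero row makes the coordinate matrix square and singular; a
    kernel vector is the relation.\<close>
  define A where "A = mat (Suc m) (Suc m) (\<lambda>(j, i). if j < m then U i j else 0)"
  have A: "A \<in> carrier_mat (Suc m) (Suc m)" by (simp add: A_def)
  have "A = mat\<^sub>r (Suc m) (Suc m) (\<lambda>j. if j = m then 0\<^sub>v (Suc m) else vec (Suc m) (\<lambda>i. U i j))"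
    by (rule eq_matI) (auto simp: A_def)
  hence "det A = 0" by (simp add: det_row_0)
  then obtain v where v: "v \<in> carrier_vec (Suc m)" "v \<noteq> 0\<^sub>v (Suc m)" "A *\<^sub>v v = 0\<^sub>v (Suc m)"
    using det_0_iff_vec_prod_zero_field[OF A] by auto
  have rel: "relation m (Suc m) U (\<lambda>i. v $ i)"
    unfolding relation_def
  proof (intro allI impI)
    fix j assume j: "j < m"
    have "(\<Sum>i<Suc m. v $ i * U i j) = (A *\<^sub>v v) $ j"
      using v(1) j by (auto simp: A_def scalar_prod_def lessThan_atLeast0 intro!: sum.cong)
    thus "(\<Sum>i<Suc m. v $ i * U i j) = 0" using v(3) j by simp
  qed
  have "v $ i \<noteq> 0" if "i \<le> m" for i
  proof
    assume "v $ i = 0"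
    hence "\<forall>i<Suc m. v $ i = 0"
      using gp rel that unfolding gen_pos_def by (metis less_Suc_eq_le)
    hence "v = 0\<^sub>v (Suc m)" using v(1) by (intro eq_vecI) auto
    thus False using v(2) by simp
  qed
  thus ?thesis using that rel by blast
qed

lemma relation_diff_scaled:
  assumes "relation d m U a" "relation d m U b"
  shows "relation d m U (\<lambda>i. a i - c * b i)"
proof -
  have "(\<Sum>i<m. (a i - c * b i) * U i j) = (\<Sum>i<m. a i * U i j) - c * (\<Sum>i<m. b i * U i j)" for j
    by (simp add: left_diff_distrib sum_subtractf sum_distrib_left mult.assoc)
  thus ?thesis using assms by (simp add: relation_def)
qed

text \<open>Subtracting the multiple of \<open>v\<close> that cancels coefficient 0 leaves a
  relation with a zero coefficient, which general position makes trivial.\<close>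

lemma relation_unique_up_to_scaling:
  assumes gp: "gen_pos d m U" and v: "relation d m U v" "\<And>i. i < m \<Longrightarrow> v i \<noteq> 0"
    and a: "relation d m U a"
  shows "\<exists>c. \<forall>i<m. a i = c * v i"
proof (cases "m = 0")
  case False
  let ?c = "a 0 / v 0"
  have "relation d m U (\<lambda>i. a i - ?c * v i)"
    by (rule relation_diff_scaled[OF a v(1)])
  moreover have "a 0 - ?c * v 0 = 0" using v(2) False by simp
  ultimately have "\<forall>i<m. a i - ?c * v i = 0"
    using gp False unfolding gen_pos_def by blast
  thus ?thesis by (intro exI[of _ ?c]) (simp only: right_minus_eq)
qed simp

text \<open>Serves to select two neighbouring slopes: the least value and the least one above
  it.\<close>

lemma ex_consecutive_values:
  fixes f :: "'a \<Rightarrow> 'b::linorder"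
  assumes A: "finite A" and xy: "x \<in> A" "y \<in> A" "f x \<noteq> f y"
  obtains i j where "i \<in> A" "j \<in> A" "f i < f j" "\<And>k. k \<in> A \<Longrightarrow> f k \<le> f i \<or> f j \<le> f k"
proof -
  have "Min (f ` A) \<in> f ` A" using A xy by (intro Min_in) auto
  then obtain i where i: "i \<in> A" "f i = Min (f ` A)" by auto
  have le: "f i \<le> f k" if "k \<in> A" for k using A that i by simp
  let ?B = "{k \<in> A. f i < f k}"
  have "f i < f x \<or> f i < f y" using le[OF xy(1)] le[OF xy(2)] xy(3) by auto
  hence "?B \<noteq> {}" using xy by auto
  hence "Min (f ` ?B) \<in> f ` ?B" using A by (intro Min_in) auto
  then obtain j where j: "j \<in> ?B" "f j = Min (f ` ?B)" by auto
  have "f k \<le> f i \<or> f j \<le> f k" if "k \<in> A" for k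
    using that A j by (cases "f i < f k") auto
  thus ?thesis using that i j by blast
qed


section \<open>Merging two generators\<close>

text \<open>Numbers \<open>{..m}\<close> without \<open>q\<close> by \<open>{..<m}\<close>, index
  \<open>m\<close> filling the gap. It serves to drop a generator and also to drop a
  coordinate.\<close>

definition skip :: "nat \<Rightarrow> nat \<Rightarrow> nat \<Rightarrow> nat" where
  "skip q m k = (if k = q then m else k)"

lemma bij_betw_skip:
  assumes "q \<le> m"
  shows "bij_betw (skip q m) {..<m} ({..<Suc m} - {q})"
  by (rule bij_betw_byWitness[where f' = "\<lambda>k. if k = m then q else k"])
    (use assms in \<open>auto simp: skip_def\<close>)

lemma skip_surj:
  assumes "q \<le> m" "k \<le> m" "k \<noteq> q"
  obtains k' where "k' < m" "skip q m k' = k"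
  using bij_betw_imp_surj_on[OF bij_betw_skip[OF assms(1)]] assms(2,3)
  by (metis Diff_iff imageE insertE empty_iff le_imp_less_Suc lessThan_iff)

lemma skip_less: "q \<le> m \<Longrightarrow> k < m \<Longrightarrow> skip q m k < Suc m \<and> skip q m k \<noteq> q"
  by (auto simp: skip_def)

text \<open>Generator \<open>j\<close> stays in place here; \<open>skip j m\<close> leaves it out
  afterwards.\<close>

definition merge :: "nat \<Rightarrow> nat \<Rightarrow> real \<Rightarrow> (nat \<Rightarrow> nat \<Rightarrow> real) \<Rightarrow> nat \<Rightarrow> nat \<Rightarrow> real" where
  "merge i j s U k l = (if k = i then U i l + s * U j l else U k l)"

text \<open>The coefficient \<open>a i\<close> of the merged generator contributes
  \<open>a i\<close> to \<open>U i\<close> and \<open>s * a i\<close>, which is \<open>a j\<close>,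
  to \<open>U j\<close>.\<close>

lemma sum_merge:
  assumes ij: "i < Suc m" "j < Suc m" "i \<noteq> j" and a: "a j = s * a i"
  shows "(\<Sum>k<m. a (skip j m k) * merge i j s U (skip j m k) l) = (\<Sum>k<Suc m. a k * U k l)"
proof -
  let ?S = "{..<Suc m} - {j}"
  have "(\<Sum>k<m. a (skip j m k) * merge i j s U (skip j m k) l) = (\<Sum>k\<in>?S. a k * merge i j s U k l)"
    by (rule sum.reindex_bij_betw[OF bij_betw_skip]) (use ij in simp)
  also have "\<dots> = (\<Sum>k\<in>?S. a k * U k l + (if k = i then a j * U j l else 0))"
    by (intro sum.cong) (auto simp: merge_def a algebra_simps)
  also have "\<dots> = (\<Sum>k\<in>?S. a k * U k l) + a j * U j l"
    using ij by (simp add: sum.distrib)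
  also have "\<dots> = (\<Sum>k<Suc m. a k * U k l)"
    using ij by (subst (2) sum.remove[of _ j]) (auto simp: add.commute)
  finally show ?thesis .
qed

text \<open>Lifts arbitrary coefficients \<open>b\<close> of the merged family to coefficients of
  the form that \<open>sum_merge\<close> asks for.\<close>

lemma ex_unmerge:
  assumes ij: "i < Suc m" "j < Suc m" "i \<noteq> j"
  obtains a :: "nat \<Rightarrow> real"
  where "a j = s * a i" "\<And>k. k < m \<Longrightarrow> a (skip j m k) = b k"
proof
  \<comment> \<open>\<open>?h\<close> inverts \<open>skip j m\<close>.\<close>
  let ?h = "\<lambda>k. if k = m then j else k"
  let ?a = "\<lambda>k. if k = j then s * b (?h i) else b (?h k)"
  show "?a j = s * ?a i" using ij by simp
  show "?a (skip j m k) = b k" if "k < m" for k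
    using that ij by (auto simp: skip_def)
qed

text \<open>By \<open>eq\<close>, a nonzero affine function would have its only zero strictly
  between \<open>x\<close> and \<open>y\<close>, but \<open>z\<close> is a zero outside that
  interval.\<close>

lemma affine_no_zero:
  fixes \<alpha> \<beta> x y z :: real
  assumes "x < y" "z \<le> x \<or> y \<le> z" "\<alpha> * z + \<beta> = 0" "P > 0" "Q > 0"
    and eq: "P * (\<alpha> * x + \<beta>) + Q * (\<alpha> * y + \<beta>) = 0"
  shows "\<alpha> = 0 \<and> \<beta> = 0"
proof -
  have \<beta>: "\<beta> = - (\<alpha> * z)" using assms(3) by simp
  have e: "\<alpha> * (P * (x - z) + Q * (y - z)) = 0"
    using eq by (simp add: \<beta> algebra_simps)
  have "P * (x - z) + Q * (y - z) \<noteq> 0"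
    using assms(2)
  proof
    assume "z \<le> x"
    hence "P * (x - z) \<ge> 0" "Q * (y - z) > 0" using assms by auto
    thus ?thesis by linarith
  next
    assume "y \<le> z"
    hence "P * (z - x) > 0" "Q * (z - y) \<ge> 0" using assms by auto
    thus ?thesis by (simp add: algebra_simps)
  qed
  thus ?thesis using e \<beta> by simp
qed


section \<open>Projection along a short lattice vector\<close>

text \<open>The short vector lies on axis \<open>p\<close>, so projecting along it is deleting
  coordinate \<open>p\<close>, and the projected lattice is again the standard one.\<close>

lemma lonely_coeffs_axis_direction:
  fixes w :: int
  assumes m: "m \<ge> 1"
    and conj: "\<And>U. integral_gens (m - 1) m U \<Longrightarrow> gen_pos (m - 1) m U \<Longrightarrow> lonely_coeffs (m - 1) m U"
    and int: "integral_gens m (Suc m) U" and gp: "gen_pos m (Suc m) U"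
    and r: "\<And>i. i \<le> m \<Longrightarrow> \<bar>r i\<bar> \<le> 2 / ((real m + 1) * (real m + 2))"
    and p: "p < m"
    and w: "(\<Sum>i<Suc m. r i * U i p) = of_int w" "w \<noteq> 0"
    and w0: "\<And>j. j < m \<Longrightarrow> j \<noteq> p \<Longrightarrow> (\<Sum>i<Suc m. r i * U i j) = 0"
  shows "lonely_coeffs m (Suc m) U"
proof -
  obtain v where v: "relation m (Suc m) U v" and vne: "\<And>i. i \<le> m \<Longrightarrow> v i \<noteq> 0"
    using ex_nowhere_zero_relation[OF gp] by blast
  define \<rho> where "\<rho> = (\<lambda>k. r k / v k)"
  \<comment> \<open>Equal slopes would make \<open>r\<close> a multiple of \<open>v\<close>, hence a
    relation, against \<open>w \<noteq> 0\<close>.\<close>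
  have "\<exists>k\<in>{..m}. \<rho> k \<noteq> \<rho> 0"
  proof (rule ccontr)
    assume "\<not> ?thesis"
    hence eq: "\<rho> i = \<rho> 0" if "i \<le> m" for i using that by blast
    have "r i = \<rho> 0 * v i" if "i \<le> m" for i
      unfolding eq[OF that, symmetric] using vne[OF that] by (simp add: \<rho>_def)
    hence "(\<Sum>i<Suc m. r i * U i p) = (\<Sum>i<Suc m. \<rho> 0 * (v i * U i p))"
      by (intro sum.cong) auto
    also have "\<dots> = \<rho> 0 * (\<Sum>i<Suc m. v i * U i p)"
      by (rule sum_distrib_left[symmetric])
    also have "\<dots> = 0" using v p by (simp add: relation_def)
    finally show False using w by simp
  qed
  then obtain k0 where "k0 \<in> {..m}" "\<rho> k0 \<noteq> \<rho> 0" by blast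
  then obtain i j where ij: "i \<le> m" "j \<le> m" "\<rho> i < \<rho> j"
    and between: "\<And>k. k \<le> m \<Longrightarrow> \<rho> k \<le> \<rho> i \<or> \<rho> j \<le> \<rho> k"
    using ex_consecutive_values[of "{..m}" k0 0 \<rho>] by auto
  have ne: "i \<noteq> j" using ij by auto
  \<comment> \<open>This sign makes both weights in \<open>balance\<close> below positive.\<close>
  define s where "s = - sgn (v i * v j)"
  have s: "s = 1 \<or> s = - 1"
    using vne[OF ij(1)] vne[OF ij(2)] by (auto simp: s_def sgn_if)
  define U' where "U' = (\<lambda>k l. merge i j s U (skip j m k) (skip p (m - 1) l))"
  have skp: "skip p (m - 1) l < m \<and> skip p (m - 1) l \<noteq> p" if "l < m - 1" for l
    using skip_less[of p "m - 1" l] p that by auto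
  have U': "(\<Sum>k<m. a (skip j m k) * U' k l) = (\<Sum>k<Suc m. a k * U k (skip p (m - 1) l))"
    if "a j = s * a i" for a l
    unfolding U'_def using that ij ne by (intro sum_merge) auto

  have "integral_gens (m - 1) m U'"
  proof -
    have "s \<in> \<int>" using s by auto
    moreover have "U k l \<in> \<int>" if "k \<le> m" "l < m" for k l
      using int that by (simp add: integral_gens_def)
    ultimately have "merge i j s U k l \<in> \<int>" if "k \<le> m" "l < m" for k l
      using that ij by (auto simp: merge_def)
    thus ?thesis
      unfolding integral_gens_def U'_def
      using skp skip_less[OF ij(2)] by (meson less_Suc_eq_le)
  qed
  moreover have "gen_pos (m - 1) m U'"
    unfolding gen_pos_def
  proof (intro allI impI)
    fix b k1 assume rel: "relation (m - 1) m U' b" and "\<exists>k<m. b k = 0" and k1: "k1 < m"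
    then obtain k where k: "k < m" "b k = 0" by blast
    obtain a where aj: "a j = s * a i" and ab: "\<And>k. k < m \<Longrightarrow> a (skip j m k) = b k"
      by (rule ex_unmerge[of i m j s b]) (use ij ne in auto)
    \<comment> \<open>The lifted coefficients produce a vector that vanishes off coordinate
      \<open>p\<close>, hence \<open>\<alpha>\<close> times the short vector.\<close>
    define A where "A = (\<lambda>l. \<Sum>k<Suc m. a k * U k l)"
    have A0: "A l = 0" if l: "l < m" "l \<noteq> p" for l
    proof -
      obtain l' where l': "l' < m - 1" "skip p (m - 1) l' = l"
        by (rule skip_surj[of p "m - 1" l]) (use p l in auto)
      have "A l = (\<Sum>k<m. a (skip j m k) * U' k l')"
        unfolding A_def U'[of a l', OF aj] l'(2) ..
      also have "\<dots> = (\<Sum>k<m. b k * U' k l')" using ab by (intro sum.cong) auto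
      finally show ?thesis using rel l'(1) by (simp add: relation_def)
    qed
    define \<alpha> where "\<alpha> = A p / of_int w"
    \<comment> \<open>Removing \<open>\<alpha>\<close> times \<open>r\<close> leaves a true
      relation, a multiple of \<open>v\<close>; thus \<open>a k / v k\<close> is an affine function
      of the slope \<open>\<rho> k\<close>.\<close>
    have "relation m (Suc m) U (\<lambda>i. a i - \<alpha> * r i)"
      unfolding relation_def
    proof (intro allI impI)
      fix l assume l: "l < m"
      have "(\<Sum>i<Suc m. (a i - \<alpha> * r i) * U i l) = A l - \<alpha> * (\<Sum>i<Suc m. r i * U i l)"
        unfolding A_def left_diff_distrib sum_subtractf sum_distrib_left mult.assoc ..
      also have "\<dots> = 0"
        using A0[OF l] w0[OF l] w by (cases "l = p") (simp_all add: \<alpha>_def)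
      finally show "(\<Sum>i<Suc m. (a i - \<alpha> * r i) * U i l) = 0" .
    qed
    hence "\<exists>c. \<forall>i<Suc m. a i - \<alpha> * r i = c * v i"
      using vne by (intro relation_unique_up_to_scaling[OF gp v]) auto
    then obtain \<beta> where \<beta>: "\<forall>i<Suc m. a i - \<alpha> * r i = \<beta> * v i" ..
    have a: "a k = v k * (\<alpha> * \<rho> k + \<beta>)" if "k \<le> m" for k
      using \<beta>[rule_format, of k] that vne[OF that] by (simp add: \<rho>_def field_simps)
    have km: "skip j m k \<le> m" using skip_less[OF ij(2) k(1)] by simp
    \<comment> \<open>The vanishing coefficient gives this affine function a zero at a slope that
      \<open>between\<close> keeps out of the open interval from \<open>\<rho> i\<close> to
      \<open>\<rho> j\<close>.\<close>
    have zero: "\<alpha> * \<rho> (skip j m k) + \<beta> = 0"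
      using a[of "skip j m k"] ab[OF k(1)] k skip_less[OF ij(2) k(1)] vne[of "skip j m k"] by auto
    have balance: "\<bar>v i\<bar> * (\<alpha> * \<rho> i + \<beta>) + \<bar>v j\<bar> * (\<alpha> * \<rho> j + \<beta>) = 0"
    proof -
      have "\<bar>v j\<bar> * (\<alpha> * \<rho> j + \<beta>) = sgn (v j) * a j"
        by (simp add: a[OF ij(2)] abs_sgn mult_ac)
      also have "\<dots> = - (sgn (v j) * sgn (v j)) * (sgn (v i) * a i)"
        by (simp add: aj s_def sgn_mult)
      also have "sgn (v j) * sgn (v j) = 1"
        using vne[OF ij(2)] by (simp add: sgn_if)
      also have "sgn (v i) * a i = \<bar>v i\<bar> * (\<alpha> * \<rho> i + \<beta>)"
        by (simp add: a[OF ij(1)] abs_sgn mult_ac)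
      finally show ?thesis by simp
    qed
    have "\<alpha> = 0 \<and> \<beta> = 0"
      using vne[OF ij(1)] vne[OF ij(2)]
      by (intro affine_no_zero[OF ij(3) between[OF km] zero _ _ balance]) simp_all
    hence "a (skip j m k1) = 0" using a skip_less[OF ij(2) k1] by simp
    thus "b k1 = 0" using ab[OF k1] by simp
  qed
  ultimately have "lonely_coeffs (m - 1) m U'" by (rule conj)
  then obtain b where b: "\<And>k. k < m \<Longrightarrow> 1 / (real m + 1) \<le> b k \<and> b k \<le> real m / (real m + 1)"
    and bint: "\<And>l. l < m - 1 \<Longrightarrow> (\<Sum>k<m. b k * U' k l) \<in> \<int>"
    unfolding lonely_coeffs_def by blast
  obtain a where aj: "a j = s * a i" and ab: "\<And>k. k < m \<Longrightarrow> a (skip j m k) = b k"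
    by (rule ex_unmerge[of i m j s b]) (use ij ne in auto)
  have abd: "1 / (real m + 1) \<le> a k \<and> a k \<le> real m / (real m + 1)" if "k \<le> m" "k \<noteq> j" for k
    using skip_surj[OF ij(2) that] ab b by metis
  text \<open>For \<open>s = -1\<close> the coefficient of \<open>u\<^sub>j\<close> is moved back into the unit interval by adding
    the lattice vector \<open>u\<^sub>j\<close>.\<close>
  define t where "t = (\<lambda>k. a k + (if k = j \<and> s = - 1 then 1 else 0))"
  have tbd: "1 / (real m + 1) \<le> t k \<and> t k \<le> real m / (real m + 1)" if "k \<le> m" for k
  proof (cases "k = j \<and> s = - 1")
    case True
    hence "t k = 1 - a i" by (simp add: t_def aj)
    moreover have "1 - 1 / (real m + 1) = real m / (real m + 1)" by (simp add: field_simps)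
    ultimately show ?thesis using abd[OF ij(1) ne] by linarith
  next
    case False
    thus ?thesis using abd[OF that] abd[OF ij(1) ne] s by (cases "k = j") (auto simp: t_def aj)
  qed
  define T where "T = (\<lambda>l. \<Sum>k<Suc m. t k * U k l)"
  \<comment> \<open>Coordinates other than \<open>p\<close> survive the projection, so
    \<open>b\<close> already makes them integral.\<close>
  have Tint: "T l \<in> \<int>" if l: "l < m" "l \<noteq> p" for l
  proof -
    obtain l' where l': "l' < m - 1" "skip p (m - 1) l' = l"
      by (rule skip_surj[of p "m - 1" l]) (use p l in auto)
    have "(\<Sum>k<Suc m. a k * U k l) = (\<Sum>k<m. a (skip j m k) * U' k l')"
      unfolding U'[of a l', OF aj] l'(2) ..
    also have "\<dots> = (\<Sum>k<m. b k * U' k l')" using ab by (intro sum.cong) auto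
    finally have "(\<Sum>k<Suc m. a k * U k l) \<in> \<int>" using bint[OF l'(1)] by simp
    moreover have "T l = (\<Sum>k<Suc m. a k * U k l) + (\<Sum>k<Suc m. (if k = j \<and> s = - 1 then 1 else 0) * U k l)"
      unfolding T_def t_def distrib_right sum.distrib ..
    moreover have "(\<Sum>k<Suc m. (if k = j \<and> s = - 1 then 1 else 0) * U k l) \<in> \<int>"
      using int l by (intro Ints_sum) (auto simp: integral_gens_def)
    ultimately show ?thesis by simp
  qed
  \<comment> \<open>Subtracting \<open>\<gamma>\<close> times the short vector rounds coordinate
    \<open>p\<close> to the nearest integer and fixes the others;
    \<open>\<bar>w\<bar> \<ge> 1\<close> keeps \<open>\<gamma>\<close> within
    \<open>1/2\<close>.\<close>
  define \<gamma> where "\<gamma> = (T p - of_int (round (T p))) / of_int w"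
  have \<gamma>: "\<bar>\<gamma>\<bar> \<le> 1/2"
  proof -
    have "\<bar>T p - of_int (round (T p))\<bar> \<le> 1/2"
      using of_int_round_abs_le[of "T p"] by linarith
    moreover have "1 \<le> \<bar>real_of_int w\<bar>" using w(2) by linarith
    ultimately show ?thesis
      unfolding \<gamma>_def abs_divide by (simp add: divide_le_eq)
  qed
  have shifted: "(\<Sum>k<Suc m. (t k - \<gamma> * r k) * U k l) = T l - \<gamma> * (\<Sum>i<Suc m. r i * U i l)" for l
    unfolding T_def left_diff_distrib sum_subtractf sum_distrib_left mult.assoc ..
  show ?thesis
    unfolding lonely_coeffs_def
  proof (intro exI[of _ "\<lambda>k. t k - \<gamma> * r k"] conjI allI impI)
    fix l assume l: "l < m"
    show "(\<Sum>k<Suc m. (t k - \<gamma> * r k) * U k l) \<in> \<int>"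
    proof (cases "l = p")
      case True
      thus ?thesis unfolding shifted using w by (simp add: \<gamma>_def)
    next
      case False
      thus ?thesis unfolding shifted using Tint[OF l] w0[OF l] by simp
    qed
  next
    fix k assume "k < Suc m"
    hence k: "k \<le> m" by simp
    have "\<bar>\<gamma> * r k\<bar> \<le> 1/2 * (2 / ((real m + 1) * (real m + 2)))"
      unfolding abs_mult using \<gamma> r[OF k] by (intro mult_mono) auto
    hence g: "\<bar>\<gamma> * r k\<bar> \<le> 1 / ((real m + 1) * (real m + 2))" by simp
    \<comment> \<open>The permitted shift is exactly the gap between the bounds for \<open>m\<close>
      generators and those for \<open>m + 1\<close>.\<close>
    have e: "1 / (real m + 1) - 1 / ((real m + 1) * (real m + 2)) = 1 / (real (Suc m) + 1)"
      "real m / (real m + 1) + 1 / ((real m + 1) * (real m + 2)) = real (Suc m) / (real (Suc m) + 1)"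
      by (simp_all add: divide_simps) (simp_all add: algebra_simps)
    show "1 / (real (Suc m) + 1) \<le> t k - \<gamma> * r k" "t k - \<gamma> * r k \<le> real (Suc m) / (real (Suc m) + 1)"
      using tbd[OF k] g unfolding e[symmetric] by linarith+
  qed
qed


text \<open>Euclid's algorithm on the entries of \<open>w\<close>, run as a sequence of shears of the lattice, leads
  to the case where \<open>w\<close> points along a coordinate axis.\<close>
lemma lonely_coeffs_short_vector:
  fixes w :: "nat \<Rightarrow> int"
  assumes m: "m \<ge> 1"
    and conj: "\<And>U. integral_gens (m - 1) m U \<Longrightarrow> gen_pos (m - 1) m U \<Longrightarrow> lonely_coeffs (m - 1) m U"
    and r: "\<And>i. i \<le> m \<Longrightarrow> \<bar>r i\<bar> \<le> 2 / ((real m + 1) * (real m + 2))"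
  shows "integral_gens m (Suc m) U \<Longrightarrow> gen_pos m (Suc m) U \<Longrightarrow>
    (\<And>j. j < m \<Longrightarrow> (\<Sum>i<Suc m. r i * U i j) = of_int (w j)) \<Longrightarrow> \<exists>j<m. w j \<noteq> 0 \<Longrightarrow>
    lonely_coeffs m (Suc m) U"
proof (induction "\<Sum>j<m. nat \<bar>w j\<bar>" arbitrary: w U rule: less_induct)
  case less
  note int = less.prems(1) and gp = less.prems(2) and w = less.prems(3)
  obtain p where p: "p < m" "w p \<noteq> 0" using less.prems(4) by blast
  show ?case
  proof (cases "\<exists>q<m. q \<noteq> p \<and> w q \<noteq> 0")
    case False
    show ?thesis
    proof (rule lonely_coeffs_axis_direction[OF m conj int gp r p(1) w[OF p(1)] p(2)])
      show "(\<Sum>i<Suc m. r i * U i j) = 0" if "j < m" "j \<noteq> p" for j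
      proof -
        have "w j = 0" using False that by blast
        thus ?thesis unfolding w[OF that(1)] by simp
      qed
    qed
  next
    case True
    then obtain p q where p: "p < m" "w p \<noteq> 0" and q: "q < m" "w q \<noteq> 0" and ne: "p \<noteq> q"
      and le: "\<bar>w p\<bar> \<le> \<bar>w q\<bar>"
      using p by (metis linear)
    \<comment> \<open>\<open>s * w p\<close> has the sign of \<open>w q\<close>, so subtracting it
      lowers \<open>\<bar>w q\<bar>\<close> by \<open>\<bar>w p\<bar>\<close>, and the sum of
      absolute values drops.\<close>
    define s where "s = sgn (w p) * sgn (w q)"
    define w' where "w' = w(q := w q - s * w p)"
    \<comment> \<open>The same shear applied to the generators: it is unimodular, so lattice and
      relations are preserved.\<close>
    define U' where "U' = (\<lambda>i. (U i)(q := U i q - of_int s * U i p))"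
    have sumU': "(\<Sum>i<Suc m. a i * U' i j) =
        (if j = q then (\<Sum>i<Suc m. a i * U i q) - of_int s * (\<Sum>i<Suc m. a i * U i p)
         else (\<Sum>i<Suc m. a i * U i j))" for a j
      unfolding sum_distrib_left sum_subtractf[symmetric]
      by (auto simp: U'_def algebra_simps)
    have decr: "(\<Sum>j<m. nat \<bar>w' j\<bar>) < (\<Sum>j<m. nat \<bar>w j\<bar>)"
    proof (rule sum_strict_mono_ex1)
      have "\<bar>w q - s * w p\<bar> < \<bar>w q\<bar>"
        using p(2) q(2) le by (auto simp: s_def sgn_if abs_if split: if_splits)
      hence lt: "nat \<bar>w' q\<bar> < nat \<bar>w q\<bar>" by (simp add: w'_def)
      thus "\<exists>j\<in>{..<m}. nat \<bar>w' j\<bar> < nat \<bar>w j\<bar>" using q(1) by blast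
      show "\<forall>j\<in>{..<m}. nat \<bar>w' j\<bar> \<le> nat \<bar>w j\<bar>"
        using lt by (auto simp: w'_def)
    qed simp
    have int': "integral_gens m (Suc m) U'"
      using int p q by (auto simp: integral_gens_def U'_def)
    have rel: "relation m (Suc m) U a" if a: "relation m (Suc m) U' a" for a
      unfolding relation_def
    proof (intro allI impI)
      fix j assume j: "j < m"
      have *: "(\<Sum>i<Suc m. a i * U' i l) = 0" if "l < m" for l
        using a that by (simp only: relation_def)
      have "(\<Sum>i<Suc m. a i * U i p) = 0"
        using *[OF p(1)] ne unfolding sumU' by (simp only: if_False)
      thus "(\<Sum>i<Suc m. a i * U i j) = 0"
        using *[OF j] unfolding sumU' by (cases "j = q") (simp_all only: if_True if_False mult_zero_right diff_zero simp_thms)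
    qed
    have gp': "gen_pos m (Suc m) U'"
      using gp rel unfolding gen_pos_def by blast
    have w': "(\<Sum>i<Suc m. r i * U' i j) = of_int (w' j)" if "j < m" for j
      unfolding sumU' w[OF p(1)] w[OF q(1)] w[OF that] by (simp add: w'_def)
    \<comment> \<open>Entry \<open>p\<close> is untouched by the shear, so the new vector is again
      nonzero.\<close>
    have "w' p \<noteq> 0" using ne p by (simp add: w'_def)
    hence "\<exists>j<m. w' j \<noteq> 0" using p by blast
    hence "lonely_coeffs m (Suc m) U'"
      by (intro less.hyps[OF decr int' gp' w'])
    then obtain t where t: "\<forall>i<Suc m. 1 / (real (Suc m) + 1) \<le> t i \<and> t i \<le> real (Suc m) / (real (Suc m) + 1)"
      and ti: "\<And>j. j < m \<Longrightarrow> (\<Sum>i<Suc m. t i * U' i j) \<in> \<int>"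
      unfolding lonely_coeffs_def by blast
    have tp: "(\<Sum>i<Suc m. t i * U i p) \<in> \<int>"
      using ti[OF p(1)] ne unfolding sumU' by (simp only: if_False)
    have "(\<Sum>i<Suc m. t i * U i j) \<in> \<int>" if j: "j < m" for j
    proof (cases "j = q")
      case True
      \<comment> \<open>Undoing the shear adds an integer multiple of the integral coordinate
        \<open>p\<close>.\<close>
      have "(\<Sum>i<Suc m. t i * U i q) = (\<Sum>i<Suc m. t i * U' i q) + of_int s * (\<Sum>i<Suc m. t i * U i p)"
        unfolding sumU' by simp
      thus ?thesis using True ti[OF q(1)] tp by (simp only: Ints_add Ints_mult Ints_of_int)
    next
      case False
      thus ?thesis using ti[OF j] unfolding sumU' by (simp only: if_False)
    qed
    thus ?thesis using t unfolding lonely_coeffs_def by blast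
  qed
qed

section \<open>Lattice points congruent modulo N\<close>

text \<open>All notions involved look only at coordinates below \<open>m - 1\<close>, so cutting the
  rows of \<open>U\<close> down to vectors loses nothing.\<close>

lemma lonely_coeffs_of_conjecture_B:
  assumes m: "m \<ge> 1" and conj: "conjecture_B m"
    and int: "integral_gens (m - 1) m U" and gp: "gen_pos (m - 1) m U"
  shows "lonely_coeffs (m - 1) m U"
proof -
  define u where "u = (\<lambda>i. vec (m - 1) (U i))"
  have u: "\<forall>i<m. u i \<in> carrier_vec (m - 1)" by (simp add: u_def)
  have uU: "u i $ j = U i j" if "j < m - 1" for i j using that by (simp add: u_def)
  have "relation (m - 1) m (\<lambda>i j. u i $ j) = relation (m - 1) m U"
    by (rule ext) (simp add: relation_def uU)
  hence "gen_pos (m - 1) m (\<lambda>i j. u i $ j)" using gp by (simp only: gen_pos_def)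
  moreover have "integral_gens (m - 1) m (\<lambda>i j. u i $ j)"
    using int by (simp add: integral_gens_def uU)
  ultimately have "lonely_runner_zonotope m u"
    using m u unfolding lonely_runner_zonotope_iff by blast
  hence "satisfies_B m u" using conj unfolding conjecture_B_def by blast
  hence "lonely_coeffs (m - 1) m (\<lambda>i j. u i $ j)"
    unfolding satisfies_B_iff_lonely_coeffs[OF m u] .
  thus ?thesis by (simp add: lonely_coeffs_def uU)
qed

lemma zonotope_index:
  assumes "z \<in> zonotope d m u" "\<forall>i<m. u i \<in> carrier_vec d"
  obtains t where "\<And>i. i < m \<Longrightarrow> 0 \<le> t i \<and> t i \<le> 1"
    "\<And>j. j < d \<Longrightarrow> z $ j = (\<Sum>i<m. t i * u i $ j)"
proof -
  obtain t where z: "z = finsum_vec TYPE(real) d (\<lambda>i. t i \<cdot>\<^sub>v u i) {..<m}"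
    and t: "\<forall>i<m. 0 \<le> t i \<and> t i \<le> 1"
    using assms(1) unfolding zonotope_def by blast
  have "z $ j = (\<Sum>i<m. t i * u i $ j)" if "j < d" for j
  proof -
    have "z $ j = (\<Sum>i<m. (t i \<cdot>\<^sub>v u i) $ j)"
      unfolding z using that assms(2) by (intro index_finsum_vec) auto
    also have "\<dots> = (\<Sum>i<m. t i * u i $ j)"
      using that assms(2) by (intro sum.cong) auto
    finally show ?thesis .
  qed
  thus ?thesis using that t by blast
qed

text \<open>\<open>(x - y) / N\<close> is a nonzero lattice vector with small coefficients. The
  floors only turn integral real coordinates into integers.\<close>

lemma satisfies_B_if_congruent_points:
  assumes conj: "conjecture_B m" and lrz: "lonely_runner_zonotope (Suc m) u"
    and x: "x \<in> zonotope m (Suc m) u" "x \<in> int_lattice m"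
    and y: "y \<in> zonotope m (Suc m) u" "y \<in> int_lattice m"
    and ne: "x \<noteq> y"
    and cong: "\<And>j. j < m \<Longrightarrow> \<lfloor>x $ j\<rfloor> mod int ((m + 2) choose 2) = \<lfloor>y $ j\<rfloor> mod int ((m + 2) choose 2)"
  shows "satisfies_B (Suc m) u"
proof -
  define N where "N = int ((m + 2) choose 2)"
  have "((m + 2) choose 2) * 2 = (m + 1) * (m + 2)"
    using Suc_times_binomial_eq[of "m + 1" 1] by (simp add: numeral_2_eq_2)
  hence "N * 2 = int ((m + 1) * (m + 2))" unfolding N_def by (metis of_nat_mult of_nat_numeral)
  hence "real_of_int (N * 2) = real_of_int (int ((m + 1) * (m + 2)))" by (rule arg_cong)
  \<comment> \<open>So \<open>1 / N\<close> is the bound on \<open>\<bar>r i\<bar>\<close> in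
    \<open>lonely_coeffs_short_vector\<close>.\<close>
  hence N: "real_of_int N = (real m + 1) * (real m + 2) / 2" by (simp add: algebra_simps)
  have Npos: "real_of_int N > 0" unfolding N by simp
  have u: "\<forall>i<Suc m. u i \<in> carrier_vec m"
    and int: "integral_gens m (Suc m) (\<lambda>i j. u i $ j)" and gp: "gen_pos m (Suc m) (\<lambda>i j. u i $ j)"
    using lrz unfolding lonely_runner_zonotope_iff diff_Suc_1 by blast+
  have xc: "x \<in> carrier_vec m" "y \<in> carrier_vec m" using x y by (auto simp: int_lattice_def)
  \<comment> \<open>A coordinate where \<open>x\<close> and \<open>y\<close> differ also rules out
    \<open>m = 0\<close>.\<close>
  have "\<exists>j<m. x $ j \<noteq> y $ j"
  proof (rule ccontr)
    assume "\<not> ?thesis"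
    hence "x = y" using xc by (intro eq_vecI) auto
    thus False using ne by simp
  qed
  then obtain j0 where j0: "j0 < m" "x $ j0 \<noteq> y $ j0" by blast
  hence m: "m \<ge> 1" by simp
  obtain a where a: "\<And>i. i < Suc m \<Longrightarrow> 0 \<le> a i \<and> a i \<le> 1"
    "\<And>j. j < m \<Longrightarrow> x $ j = (\<Sum>i<Suc m. a i * u i $ j)"
    using zonotope_index[OF x(1) u] by blast
  obtain b where b: "\<And>i. i < Suc m \<Longrightarrow> 0 \<le> b i \<and> b i \<le> 1"
    "\<And>j. j < m \<Longrightarrow> y $ j = (\<Sum>i<Suc m. b i * u i $ j)"
    using zonotope_index[OF y(1) u] by blast
  define w where "w = (\<lambda>j. (\<lfloor>x $ j\<rfloor> - \<lfloor>y $ j\<rfloor>) div N)"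
  have w: "x $ j - y $ j = real_of_int N * of_int (w j)" if "j < m" for j
  proof -
    have "N dvd \<lfloor>x $ j\<rfloor> - \<lfloor>y $ j\<rfloor>" using cong[OF that] by (simp add: N_def mod_eq_dvd_iff)
    hence "\<lfloor>x $ j\<rfloor> - \<lfloor>y $ j\<rfloor> = N * w j" by (simp add: w_def)
    hence "real_of_int (\<lfloor>x $ j\<rfloor> - \<lfloor>y $ j\<rfloor>) = real_of_int (N * w j)" by (rule arg_cong)
    moreover have "x $ j \<in> \<int>" "y $ j \<in> \<int>" using x(2) y(2) that by (auto simp: int_lattice_def)
    ultimately show ?thesis by simp
  qed
  \<comment> \<open>Coefficients of both points lie in \<open>[0, 1]\<close>, so they differ by at
    most 1.\<close>
  define r where "r = (\<lambda>i. (a i - b i) / of_int N)"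
  have r: "\<bar>r i\<bar> \<le> 2 / ((real m + 1) * (real m + 2))" if "i \<le> m" for i
  proof -
    have "\<bar>a i - b i\<bar> \<le> 1" using a(1)[of i] b(1)[of i] that by auto
    hence "\<bar>r i\<bar> \<le> 1 / of_int N"
      using Npos unfolding r_def abs_divide by (simp add: divide_right_mono)
    thus ?thesis unfolding N by simp
  qed
  have rw: "(\<Sum>i<Suc m. r i * u i $ j) = of_int (w j)" if "j < m" for j
  proof -
    have "(\<Sum>i<Suc m. r i * u i $ j) = (\<Sum>i<Suc m. (a i * u i $ j - b i * u i $ j) / of_int N)"
      by (intro sum.cong) (auto simp: r_def left_diff_distrib)
    also have "\<dots> = (x $ j - y $ j) / of_int N"
      unfolding a(2)[OF that] b(2)[OF that] by (simp only: sum_subtractf sum_divide_distrib[symmetric])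
    also have "\<dots> = of_int (w j)" unfolding w[OF that] using Npos by simp
    finally show ?thesis .
  qed
  have "w j0 \<noteq> 0" using w[OF j0(1)] j0(2) by auto
  hence "\<exists>j<m. w j \<noteq> 0" using j0(1) by blast
  hence "lonely_coeffs m (Suc m) (\<lambda>i j. u i $ j)"
    by (intro lonely_coeffs_short_vector[OF m lonely_coeffs_of_conjecture_B[OF m conj] r int gp rw])
  thus ?thesis using satisfies_B_iff_lonely_coeffs[of "Suc m" u] u by simp
qed

theorem theorem1:
  fixes n :: nat and u :: "nat \<Rightarrow> real vec"
  assumes "n \<ge> 1"
    and "conjecture_B (n - 1)"
    and "lonely_runner_zonotope n u"
    and "\<not> satisfies_B n u"
  shows "finite (zonotope (n - 1) n u \<inter> int_lattice (n - 1)) \<and>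
    card (zonotope (n - 1) n u \<inter> int_lattice (n - 1)) \<le> ((n + 1) choose 2) ^ (n - 1)"
proof -
  obtain m where n: "n = Suc m" using assms(1) by (cases n) auto
  define N where "N = (m + 2) choose 2"
  have N: "N > 0" by (simp add: N_def)
  define S where "S = zonotope m (Suc m) u \<inter> int_lattice m"
  \<comment> \<open>The \<open>N ^ m\<close> residue vectors modulo \<open>N\<close>; for
    \<open>m = 0\<close> there is just one.\<close>
  define T where "T = {..<m} \<rightarrow>\<^sub>E {0..<int N}"
  define f where "f = (\<lambda>x. \<lambda>j\<in>{..<m}. \<lfloor>x $ j :: real\<rfloor> mod int N)"
  \<comment> \<open>Two lattice points with equal residues would make \<open>u\<close> satisfy
    Conjecture B, so residues separate the points of \<open>S\<close>.\<close>
  have inj: "inj_on f S"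
  proof (rule inj_onI, rule ccontr)
    fix x y assume x: "x \<in> S" and y: "y \<in> S" and eq: "f x = f y" and ne: "x \<noteq> y"
    have "\<lfloor>x $ j\<rfloor> mod int N = \<lfloor>y $ j\<rfloor> mod int N" if "j < m" for j
      using fun_cong[OF eq, of j] that by (simp add: f_def)
    hence "satisfies_B (Suc m) u"
      using x y ne assms(2,3) unfolding n N_def S_def
      by (intro satisfies_B_if_congruent_points[of m u x y]) simp_all
    thus False using assms(4) n by simp
  qed
  have fS: "f ` S \<subseteq> T" using N by (simp add: f_def T_def image_subset_iff restrict_PiE_iff)
  have T: "finite T" "card T = N ^ m"
    by (simp_all add: T_def finite_PiE card_PiE)
  have "finite S" using inj fS T(1) by (rule inj_on_finite)
  moreover have "card S \<le> N ^ m" using card_inj_on_le[OF inj fS T(1)] T(2) by simp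
  ultimately show ?thesis by (simp add: n S_def N_def)
qed

end
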